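(* The problem Delay is undecidable.
   Context: Temporal Datalog. Constants are partitioned into objects and integer time points; variables into object variables and time variables. A time term is a time point, a time variable, or an expression $t+k$ with $t$ a time variable and $k\in\mathbb{Z}$. Each predicate is either extensional (EDB) or intensional (IDB) and has an arity $n\ge0$, each position being of object sort or time sort; a predicate is rigid if all its positions are of object sort, and temporal if its last position is of time sort and all others are of object sort. An atom $P(t_1,\dots,t_n)$ has terms of the required sorts. A rule is $\bigwedge_i\alpha_i\to\alpha$ with $\alpha$ and all $\alpha_i$ rigid or temporal atoms, $\alpha$ IDB whenever the body is nonempty, and every head variable occurring in the body. A program is a finite set of rules. A fact is a ground rigid or temporal atom without $+$ (identified with the rule $\top\to\alpha$); a dataset is a finite set of EDB facts. Rules are read as universally quantified first-order sentences with $+$ interpreted as integer addition; $\Pi\models\alpha$ denotes entailment. A query is $Q=\langle P_Q,\Pi_Q\rangle$ with $\Pi_Q$ a program and $P_Q$ an IDB predicate of $\Pi_Q$; it is temporal if $P_Q$ is temporal. For a temporal query $Q$, dataset $D$ and time point $\tau$, $Q(D,\tau)$ is the set of tuples of objects $\vec o$ with $\Pi_Q\cup D\models P_Q(\vec o,\tau)$. A $\tau_{in}$-history is a dataset consisting of rigid facts and temporal facts with time argument $\le\tau_{in}$; a $\tau_{in}$-update is a dataset consisting of temporal facts with time argument $>\tau_{in}$. Delay: an instance is $\langle Q,d\rangle$ with $Q$ a temporal query and $d$ a nonnegative integer; Delay holds for it iff $Q(D,\tau_{in}-d)=Q(D\cup U,\tau_{in}-d)$ for every time point $\tau_{in}$,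 every $\tau_{in}$-history $D$ and every $\tau_{in}$-update $U$. *)

theory Defs
  imports Main "HOL-Library.Nat_Bijection"
begin

datatype sort = OSort | TSort

text \<open>A predicate: a name, a flag telling whether it is intensional (IDB, True) or
  extensional (EDB, False), and the list of sorts of its positions (its arity is the length).\<close>
datatype pred = Pred nat bool "sort list"

fun pred_idb :: "pred \<Rightarrow> bool" where "pred_idb (Pred _ b _) = b"
fun pred_sig :: "pred \<Rightarrow> sort list" where "pred_sig (Pred _ _ s) = s"

text \<open>Terms: object constants (objects are nat), object variables, time points (int),
  and time terms t+k with t a time variable and k an integer (t itself is t+0).\<close>
datatype tm = OC nat | OV nat | TC int | TV nat int

datatype atom = Atom pred "tm list"

datatype rule = Rule "atom list" atom

type_synonym program = "rule list"

fun tm_sort :: "tm \<Rightarrow> sort" where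
  "tm_sort (OC _) = OSort" | "tm_sort (OV _) = OSort"
| "tm_sort (TC _) = TSort" | "tm_sort (TV _ _) = TSort"

definition rigid_sig :: "sort list \<Rightarrow> bool" where
  "rigid_sig s \<longleftrightarrow> (\<forall>x\<in>set s. x = OSort)"

definition temporal_sig :: "sort list \<Rightarrow> bool" where
  "temporal_sig s \<longleftrightarrow> s \<noteq> [] \<and> last s = TSort \<and> (\<forall>x\<in>set (butlast s). x = OSort)"

fun atom_pred :: "atom \<Rightarrow> pred" where "atom_pred (Atom p _) = p"
fun atom_args :: "atom \<Rightarrow> tm list" where "atom_args (Atom _ ts) = ts"

definition wf_atom :: "atom \<Rightarrow> bool" where
  "wf_atom a \<longleftrightarrow> map tm_sort (atom_args a) = pred_sig (atom_pred a)
     \<and> (rigid_sig (pred_sig (atom_pred a)) \<or> temporal_sig (pred_sig (atom_pred a)))"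

fun tm_ovars :: "tm \<Rightarrow> nat set" where
  "tm_ovars (OV x) = {x}" | "tm_ovars _ = {}"
fun tm_tvars :: "tm \<Rightarrow> nat set" where
  "tm_tvars (TV x _) = {x}" | "tm_tvars _ = {}"

definition atom_ovars :: "atom \<Rightarrow> nat set" where
  "atom_ovars a = (\<Union>t\<in>set (atom_args a). tm_ovars t)"
definition atom_tvars :: "atom \<Rightarrow> nat set" where
  "atom_tvars a = (\<Union>t\<in>set (atom_args a). tm_tvars t)"

fun wf_rule :: "rule \<Rightarrow> bool" where
  "wf_rule (Rule body h) \<longleftrightarrow>
     wf_atom h \<and> (\<forall>a\<in>set body. wf_atom a)
     \<and> (body \<noteq> [] \<longrightarrow> pred_idb (atom_pred h))
     \<and> atom_ovars h \<subseteq> (\<Union>a\<in>set body. atom_ovars a)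
     \<and> atom_tvars h \<subseteq> (\<Union>a\<in>set body. atom_tvars a)"

definition wf_program :: "program \<Rightarrow> bool" where
  "wf_program P \<longleftrightarrow> (\<forall>r\<in>set P. wf_rule r)"

fun rule_preds :: "rule \<Rightarrow> pred set" where
  "rule_preds (Rule body h) = insert (atom_pred h) (atom_pred ` set body)"

definition program_preds :: "program \<Rightarrow> pred set" where
  "program_preds P = (\<Union>r\<in>set P. rule_preds r)"

fun ground_tm :: "tm \<Rightarrow> bool" where
  "ground_tm (OC _) = True" | "ground_tm (TC _) = True" | "ground_tm _ = False"

definition is_fact :: "atom \<Rightarrow> bool" where
  "is_fact a \<longleftrightarrow> wf_atom a \<and> (\<forall>t\<in>set (atom_args a). ground_tm t)"

definition dataset :: "atom set \<Rightarrow> bool" where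
  "dataset D \<longleftrightarrow> finite D \<and> (\<forall>a\<in>D. is_fact a \<and> \<not> pred_idb (atom_pred a))"

definition rigid_fact :: "atom \<Rightarrow> bool" where
  "rigid_fact a \<longleftrightarrow> rigid_sig (pred_sig (atom_pred a))"

definition temporal_fact_at :: "atom \<Rightarrow> int \<Rightarrow> bool" where
  "temporal_fact_at a tau \<longleftrightarrow> temporal_sig (pred_sig (atom_pred a)) \<and> last (atom_args a) = TC tau"

definition history :: "int \<Rightarrow> atom set \<Rightarrow> bool" where
  "history tin D \<longleftrightarrow> dataset D \<and>
     (\<forall>a\<in>D. rigid_fact a \<or> (\<exists>tau. tau \<le> tin \<and> temporal_fact_at a tau))"

definition update :: "int \<Rightarrow> atom set \<Rightarrow> bool" where
  "update tin U \<longleftrightarrow> dataset U \<and> (\<forall>a\<in>U. \<exists>tau. tau > tin \<and> temporal_fact_at a tau)"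

text \<open>Ground values: objects and integer time points; a ground atom is a predicate with
  a list of values. Entailment is evaluated over (Herbrand-style) interpretations whose
  object domain are the object constants and whose time domain is the integers with
  + interpreted as integer addition.\<close>
datatype val = OVal nat | TVal int

type_synonym gatom = "pred \<times> val list"

fun inst_tm :: "(nat \<Rightarrow> nat) \<Rightarrow> (nat \<Rightarrow> int) \<Rightarrow> tm \<Rightarrow> val" where
  "inst_tm so st (OC c) = OVal c"
| "inst_tm so st (OV x) = OVal (so x)"
| "inst_tm so st (TC k) = TVal k"
| "inst_tm so st (TV x k) = TVal (st x + k)"

fun inst_atom :: "(nat \<Rightarrow> nat) \<Rightarrow> (nat \<Rightarrow> int) \<Rightarrow> atom \<Rightarrow> gatom" where
  "inst_atom so st (Atom p ts) = (p, map (inst_tm so st) ts)"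

fun satisfies :: "gatom set \<Rightarrow> rule \<Rightarrow> bool" where
  "satisfies I (Rule body h) \<longleftrightarrow>
     (\<forall>so st. (\<forall>a\<in>set body. inst_atom so st a \<in> I) \<longrightarrow> inst_atom so st h \<in> I)"

definition entails :: "rule set \<Rightarrow> gatom \<Rightarrow> bool" where
  "entails R g \<longleftrightarrow> (\<forall>I. (\<forall>r\<in>R. satisfies I r) \<longrightarrow> g \<in> I)"

definition answers :: "pred \<Rightarrow> program \<Rightarrow> atom set \<Rightarrow> int \<Rightarrow> nat list set" where
  "answers PQ Pi D tau =
     {os. entails (set Pi \<union> (\<lambda>a. Rule [] a) ` D) (PQ, map OVal os @ [TVal tau])}"

definition temporal_query :: "pred \<Rightarrow> program \<Rightarrow> bool" where
  "temporal_query PQ Pi \<longleftrightarrow> wf_program Pi \<and> PQ \<in> program_preds Pi \<and> pred_idb PQ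
     \<and> temporal_sig (pred_sig PQ)"

type_synonym delay_instance = "(pred \<times> program) \<times> nat"

definition valid_delay_instance :: "delay_instance \<Rightarrow> bool" where
  "valid_delay_instance inst = (case inst of ((PQ, Pi), d) \<Rightarrow> temporal_query PQ Pi)"

definition delay_holds :: "delay_instance \<Rightarrow> bool" where
  "delay_holds inst = (case inst of ((PQ, Pi), d) \<Rightarrow>
     (\<forall>tin D U. history tin D \<longrightarrow> update tin U \<longrightarrow>
        answers PQ Pi D (tin - int d) = answers PQ Pi (D \<union> U) (tin - int d)))"

datatype recf = Zero | Succ | Proj nat | Comp recf "recf list" | Prec recf recf | Mu recf

inductive eval_recf :: "recf \<Rightarrow> nat list \<Rightarrow> nat \<Rightarrow> bool" where
  zero: "eval_recf Zero xs 0"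
| succ: "eval_recf Succ (x # xs) (Suc x)"
| proj: "i < length xs \<Longrightarrow> eval_recf (Proj i) xs (xs ! i)"
| comp: "list_all2 (\<lambda>g y. eval_recf g xs y) gs ys \<Longrightarrow> eval_recf f ys z \<Longrightarrow>
           eval_recf (Comp f gs) xs z"
| prec0: "eval_recf f xs y \<Longrightarrow> eval_recf (Prec f g) (0 # xs) y"
| precS: "eval_recf (Prec f g) (n # xs) y \<Longrightarrow> eval_recf g (y # n # xs) z \<Longrightarrow>
           eval_recf (Prec f g) (Suc n # xs) z"
| mu: "eval_recf f (n # xs) 0 \<Longrightarrow> (\<forall>m<n. \<exists>y. eval_recf f (m # xs) y \<and> y \<noteq> 0) \<Longrightarrow>
           eval_recf (Mu f) xs n"

fun enc_sort :: "sort \<Rightarrow> nat" where "enc_sort OSort = 0" | "enc_sort TSort = 1"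

fun enc_pred :: "pred \<Rightarrow> nat" where
  "enc_pred (Pred n b s) = prod_encode (n, prod_encode (if b then 1 else 0, list_encode (map enc_sort s)))"

fun enc_tm :: "tm \<Rightarrow> nat" where
  "enc_tm (OC c) = prod_encode (0, c)"
| "enc_tm (OV x) = prod_encode (1, x)"
| "enc_tm (TC k) = prod_encode (2, int_encode k)"
| "enc_tm (TV x k) = prod_encode (3, prod_encode (x, int_encode k))"

fun enc_atom :: "atom \<Rightarrow> nat" where
  "enc_atom (Atom p ts) = prod_encode (enc_pred p, list_encode (map enc_tm ts))"

fun enc_rule :: "rule \<Rightarrow> nat" where
  "enc_rule (Rule body h) = prod_encode (list_encode (map enc_atom body), enc_atom h)"

fun enc_instance :: "delay_instance \<Rightarrow> nat" where
  "enc_instance ((PQ, Pi), d) =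
     prod_encode (prod_encode (enc_pred PQ, list_encode (map enc_rule Pi)), d)"

definition decidable_problem :: "('a \<Rightarrow> bool) \<Rightarrow> ('a \<Rightarrow> nat) \<Rightarrow> ('a \<Rightarrow> bool) \<Rightarrow> bool" where
  "decidable_problem valid enc P \<longleftrightarrow>
     (\<exists>f. \<forall>x. valid x \<longrightarrow> eval_recf f [enc x] (if P x then 1 else 0))"

end

theory Submission
  imports Complex_Main Defs "HOL-Library.Countable"
begin

text \<open>Time points name the natural numbers: a fact that puts the object \<open>x\<close> at time \<open>n\<close>
  lets \<open>x\<close> denote \<open>n\<close>. Since time is ordered, a positive program can detect that an object
  denotes two different numbers, and it can compute zero, successor and hence, bottom-up over
  objects, every evaluation of a fixed recursive function \<open>f\<close>. All derived facts are carried
  forward in time only, so what an update adds after \<open>t\<close> cannot interfere with the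
  evaluation visible at \<open>t\<close>. The goal holds at \<open>t\<close> if a collision is visible at \<open>t\<close>, or if
  \<open>f(c) = 1\<close> has been derived and a trigger fact is present at time \<open>t + 1\<close>. Hence delay \<open>0\<close>
  fails exactly if \<open>f(c) = 1\<close>: without a collision the denotation is a function and the
  evaluation is sound, and conversely finitely many objects suffice for an evaluation.

  A decision procedure is then refuted by diagonalization: \<open>f\<close> reconstructs the code of
  the instance from \<open>c\<close> and runs the procedure on it, and \<open>c\<close> is the code of the rules for \<open>f\<close>.\<close>

section \<open>Recursive functions\<close>

inductive_cases eval_ZeroE: "eval_recf Zero xs y"
inductive_cases eval_SuccE: "eval_recf Succ xs y"
inductive_cases eval_ProjE: "eval_recf (Proj i) xs y"
inductive_cases eval_CompE: "eval_recf (Comp f gs) xs y"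
inductive_cases eval_Prec0E: "eval_recf (Prec f g) (0 # xs) y"
inductive_cases eval_PrecSE: "eval_recf (Prec f g) (Suc n # xs) y"
inductive_cases eval_MuE: "eval_recf (Mu f) xs y"

text \<open>Needed for the diagonal argument, where the output 0 must exclude the output 1.\<close>

lemma eval_recf_deterministic:
  "eval_recf f xs y \<Longrightarrow> eval_recf f xs y' \<Longrightarrow> y = y'"
proof (induction arbitrary: y' rule: eval_recf.induct)
  case (zero xs)
  then show ?case by (auto elim: eval_ZeroE)
next
  case (succ x xs)
  then show ?case by (auto elim: eval_SuccE)
next
  case (proj i xs)
  then show ?case by (auto elim: eval_ProjE)
next
  case (comp xs gs ys f z)
  from comp.prems obtain ys' where ys': "list_all2 (\<lambda>g y. eval_recf g xs y) gs ys'"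
    and z: "eval_recf f ys' y'"
    by (rule eval_CompE)
  have "ys = ys'"
    using comp.IH(1) ys' by (auto simp: list_all2_conv_all_nth intro!: nth_equalityI)
  with z comp.IH show ?case by blast
next
  case (prec0 f xs y g)
  then show ?case by (blast elim: eval_Prec0E)
next
  case (precS f g n xs y z)
  then show ?case by (blast elim: eval_PrecSE)
next
  case (mu f n xs)
  from mu.prems have f0: "eval_recf f (y' # xs) 0"
    and fpos: "\<forall>m<y'. \<exists>y. eval_recf f (m # xs) y \<and> y \<noteq> 0"
    by (auto elim: eval_MuE)
  show ?case
  \<comment> \<open>All arguments below either candidate have nonzero value, so the smaller of two
    distinct candidates would have both a zero and a nonzero value.\<close>
  proof (cases n y' rule: linorder_cases)
    case less
    then show ?thesis using fpos mu.IH(1) by blast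
  next
    case greater
    then show ?thesis using f0 mu.IH(2) by blast
  qed
qed

section \<open>Constants, addition and Cantor pairing as recursive functions\<close>

fun const_recf :: "nat \<Rightarrow> recf" where
  "const_recf 0 = Zero"
| "const_recf (Suc n) = Comp Succ [const_recf n]"

definition add_recf :: recf where
  "add_recf = Prec (Proj 0) (Comp Succ [Proj 0])"

definition triangle_recf :: recf where
  "triangle_recf = Prec Zero (Comp add_recf [Proj 0, Comp Succ [Proj 1]])"

text \<open>Cantor pairing as in \<open>prod_encode\<close>: the triangular number of the sum plus
  the first component.\<close>

definition pair_recf :: "recf \<Rightarrow> recf \<Rightarrow> recf" where
  "pair_recf g h = Comp add_recf [Comp triangle_recf [Comp add_recf [g, h]], g]"

lemma eval_comp1:
  "eval_recf g xs a \<Longrightarrow> eval_recf f [a] z \<Longrightarrow> eval_recf (Comp f [g]) xs z"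
  by (rule eval_recf.comp[where ys = "[a]"]) auto

lemma eval_comp2:
  "eval_recf g xs a \<Longrightarrow> eval_recf h xs b \<Longrightarrow> eval_recf f [a, b] z \<Longrightarrow>
    eval_recf (Comp f [g, h]) xs z"
  by (rule eval_recf.comp[where ys = "[a, b]"]) auto

lemma eval_proj: "i < length xs \<Longrightarrow> y = xs ! i \<Longrightarrow> eval_recf (Proj i) xs y"
  by (auto intro: eval_recf.proj)

lemma eval_const_recf: "eval_recf (const_recf n) xs n"
  by (induction n) (auto intro: eval_recf.zero eval_recf.succ eval_comp1)

lemma eval_add_recf: "eval_recf add_recf [a, b] (a + b)"
  unfolding add_recf_def
proof (induction a)
  case 0
  show ?case by (auto intro!: eval_recf.prec0 eval_proj)
next
  case (Suc a)
  then show ?case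
    by (auto intro!: eval_recf.precS eval_comp1 eval_proj eval_recf.succ)
qed

lemma eval_triangle_recf: "eval_recf triangle_recf [n] (triangle n)"
  unfolding triangle_recf_def
proof (induction n)
  case 0
  show ?case by (auto intro!: eval_recf.prec0 eval_recf.zero)
next
  case (Suc n)
  have "eval_recf (Comp add_recf [Proj 0, Comp Succ [Proj 1]]) [triangle n, n]
      (triangle n + Suc n)"
    by (rule eval_comp2[OF _ _ eval_add_recf])
      (auto intro!: eval_proj eval_comp1[OF _ eval_recf.succ])
  with Suc show ?case by (auto intro: eval_recf.precS)
qed

lemma eval_pair_recf:
  "eval_recf g xs a \<Longrightarrow> eval_recf h xs b \<Longrightarrow>
    eval_recf (pair_recf g h) xs (prod_encode (a, b))"
  unfolding pair_recf_def prod_encode_def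
  by (auto intro!: eval_comp1 eval_comp2 eval_add_recf eval_triangle_recf)

section \<open>Evaluating recursive functions in temporal Datalog\<close>

instance recf :: countable
  by countable_datatype

datatype pname = Ev recf | AllPos recf | Zr | Sc | Nt | Ge | Before | Inp | Input | Goal

instance pname :: countable
  by countable_datatype

text \<open>Countability of \<open>pname\<close> turns names that contain recursive functions into
  numeric ones. One name may occur with several arities, since the signature is part of the
  predicate.\<close>

definition idb :: "pname \<Rightarrow> nat \<Rightarrow> pred" where
  "idb p k = Pred (to_nat p) True (replicate k OSort @ [TSort])"

definition value_pred :: pred where "value_pred = Pred 0 False [OSort, TSort]"
definition trigger_pred :: pred where "trigger_pred = Pred 1 False [TSort]"

definition now :: "pname \<Rightarrow> nat list \<Rightarrow> atom" where
  "now p xs = Atom (idb p (length xs)) (map OV xs @ [TV 0 0])"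

definition nxt :: "pname \<Rightarrow> nat list \<Rightarrow> atom" where
  "nxt p xs = Atom (idb p (length xs)) (map OV xs @ [TV 0 1])"

text \<open>Body atoms for the argument variables. They secure that head variables occur in the
  body, even where no other atom mentions them, and that arguments denote numbers.\<close>

definition nats :: "nat \<Rightarrow> atom list" where
  "nats k = map (\<lambda>i. now Nt [i]) [0..<k]"

definition persist :: "pname \<Rightarrow> nat \<Rightarrow> rule" where
  "persist p k = Rule [now p [0..<k]] (nxt p [0..<k])"

text \<open>A number becomes usable only from the time point that it names: \<open>Sc\<close> is
  concluded at the larger of its two numbers, and \<open>Ge\<close> cuts off negative times.
  \<open>Before\<close> remembers that an object already has a value, so a later value of the same
  object is a collision and yields \<open>Goal\<close>.\<close>

definition base_rules :: "rule list" where
  "base_rules =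
    [Rule [] (Atom (idb Ge 0) [TC 0]),
     persist Ge 0, persist Nt 1, persist Zr 1, persist Sc 2, persist Before 1,
     persist Inp 1, persist Goal 0,
     Rule [Atom value_pred [OV 0, TV 0 0], now Ge []] (now Nt [0]),
     Rule [Atom value_pred [OV 0, TC 0]] (Atom (idb Zr 1) [OV 0, TC 0]),
     Rule [Atom value_pred [OV 0, TV 0 0], Atom value_pred [OV 1, TV 0 1], now Ge []]
       (nxt Sc [0, 1]),
     Rule [Atom value_pred [OV 0, TV 0 0], now Ge []] (nxt Before [0]),
     Rule [now Input [], Atom value_pred [OV 0, TV 0 0]] (now Inp [0]),
     Rule [now Before [0], Atom value_pred [OV 0, TV 0 0]] (now Goal [])]"

text \<open>The atom \<open>Ev f (y # xs)\<close> says that \<open>f\<close> maps the numbers denoted by the objects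
  \<open>xs\<close> to the number denoted by \<open>y\<close>; \<open>AllPos f (n # xs)\<close> says that \<open>f\<close> is
  nonzero at all arguments below \<open>n\<close>. The number \<open>k\<close> is the arity.\<close>

fun rules_for :: "nat \<Rightarrow> recf \<Rightarrow> rule list" where
  "rules_for k Zero = [Rule (now Zr [k] # nats k) (now (Ev Zero) (k # [0..<k]))]"
| "rules_for k Succ =
    (if k = 0 then [] else
      [Rule (now Sc [0, k] # nats k) (now (Ev Succ) (k # 0 # [1..<k]))])"
| "rules_for k (Proj i) =
    (if i < k then [Rule (nats k) (now (Ev (Proj i)) (i # [0..<k]))] else [])"
| "rules_for k (Comp f gs) =
    Rule (now (Ev f) (k # [Suc k..<Suc k + length gs]) # nats k @
        map (\<lambda>i. now (Ev (gs ! i)) ((Suc k + i) # [0..<k])) [0..<length gs])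
      (now (Ev (Comp f gs)) (k # [0..<k])) #
    rules_for (length gs) f @ concat (map (rules_for k) gs)"
| "rules_for k (Prec f g) =
    (if k = 0 then [] else
      Rule [now Zr [0], now (Ev f) (k # [1..<k])] (now (Ev (Prec f g)) (k # 0 # [1..<k])) #
      Rule [now Sc [0, k + 2], now (Ev (Prec f g)) (k # 0 # [1..<k]),
            now (Ev g) ((k + 1) # k # 0 # [1..<k])]
        (now (Ev (Prec f g)) ((k + 1) # (k + 2) # [1..<k])) #
      rules_for (k - 1) f @ rules_for (k + 1) g)"
| "rules_for k (Mu f) =
    Rule (now Zr [k] # nats k) (now (AllPos f) (k # [0..<k])) #
    Rule [now (AllPos f) (k # [0..<k]), now (Ev f) ((k + 1) # k # [0..<k]),
          now Sc [k + 2, k + 1], now Sc [k, k + 3]]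
      (now (AllPos f) ((k + 3) # [0..<k])) #
    Rule [now (AllPos f) (k # [0..<k]), now (Ev f) ((k + 1) # k # [0..<k]), now Zr [k + 1]]
      (now (Ev (Mu f)) (k # [0..<k])) #
    rules_for (k + 1) f"

text \<open>The result 1 is recognized as the successor of an object denoting 0. Only here does a
  body atom lie later than the head, so this is the only channel from an update to an earlier
  answer.\<close>

definition goal_rule :: "recf \<Rightarrow> rule" where
  "goal_rule f = Rule [now Inp [0], now (Ev f) [1, 0], now Zr [2], now Sc [2, 1],
      Atom trigger_pred [TV 0 1]] (now Goal [])"

definition eval_program :: "recf \<Rightarrow> program" where
  "eval_program f = goal_rule f # base_rules @ rules_for 1 f"

text \<open>The input sits in one rule outside \<open>eval_program\<close>. The code of the
  remaining rules is thus independent of \<open>c\<close> and can itself be chosen as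
  \<open>c\<close>, without a fixed-point theorem.\<close>

definition input_rule :: "nat \<Rightarrow> rule" where
  "input_rule c = Rule [] (Atom (idb Input 0) [TC (int c)])"

definition program_on :: "recf \<Rightarrow> nat \<Rightarrow> program" where
  "program_on f c = input_rule c # eval_program f"

section \<open>Well-formedness of the query\<close>

lemma idb_eq_iff [simp]: "idb p k = idb q l \<longleftrightarrow> p = q \<and> k = l"
  by (auto simp: idb_def dest: arg_cong[where f = length])

lemma pred_idb_simps [simp]:
  "pred_idb (idb p k)" "\<not> pred_idb value_pred" "\<not> pred_idb trigger_pred"
  by (auto simp: idb_def value_pred_def trigger_pred_def)

lemma pred_sig_simps [simp]:
  "pred_sig (idb p k) = replicate k OSort @ [TSort]"
  "pred_sig value_pred = [OSort, TSort]" "pred_sig trigger_pred = [TSort]"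
  by (auto simp: idb_def value_pred_def trigger_pred_def)

lemma temporal_sig_simps [simp]:
  "temporal_sig (replicate k OSort @ [TSort])"
  "temporal_sig [OSort, TSort]" "temporal_sig [TSort]"
  by (auto simp: temporal_sig_def)

lemma map_tm_sort_OV [simp]: "map (tm_sort \<circ> OV) xs = replicate (length xs) OSort"
  by (induction xs) auto

lemma wf_atom_simps [simp]:
  "wf_atom (now p xs)" "wf_atom (nxt p xs)"
  "tm_sort t = TSort \<Longrightarrow> wf_atom (Atom (idb p 0) [t])"
  "tm_sort s = OSort \<Longrightarrow> tm_sort t = TSort \<Longrightarrow> wf_atom (Atom (idb p (Suc 0)) [s, t])"
  "tm_sort s = OSort \<Longrightarrow> tm_sort t = TSort \<Longrightarrow> wf_atom (Atom value_pred [s, t])"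
  "tm_sort t = TSort \<Longrightarrow> wf_atom (Atom trigger_pred [t])"
  using temporal_sig_simps(1)[of 1]
  by (auto simp: wf_atom_def now_def nxt_def)

lemma atom_simps [simp]:
  "atom_pred (now p xs) = idb p (length xs)" "atom_pred (nxt p xs) = idb p (length xs)"
  "atom_ovars (now p xs) = set xs" "atom_ovars (nxt p xs) = set xs"
  "atom_tvars (now p xs) = {0}" "atom_tvars (nxt p xs) = {0}"
  "atom_ovars (Atom q []) = {}" "atom_tvars (Atom q []) = {}"
  "atom_ovars (Atom q (t # ts)) = tm_ovars t \<union> atom_ovars (Atom q ts)"
  "atom_tvars (Atom q (t # ts)) = tm_tvars t \<union> atom_tvars (Atom q ts)"
  by (auto simp: now_def nxt_def atom_ovars_def atom_tvars_def)

lemma nats_simps [simp]: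
  "a \<in> set (nats k) \<Longrightarrow> wf_atom a"
  "(\<Union>a\<in>set (nats k). atom_ovars a) = {0..<k}"
  "i < k \<Longrightarrow> \<exists>a\<in>set (nats k). 0 \<in> atom_tvars a"
  by (auto simp: nats_def)

lemma wf_rules_for: "r \<in> set (rules_for k f) \<Longrightarrow> wf_rule r"
  by (induction k f rule: rules_for.induct) (auto split: if_splits)

lemma wf_base_rules: "r \<in> set base_rules \<Longrightarrow> wf_rule r"
  by (auto simp: base_rules_def persist_def)

lemma wf_program_on: "wf_program (program_on f c)"
  using wf_rules_for[of _ 1 f] wf_base_rules
  by (auto simp: wf_program_def program_on_def eval_program_def input_rule_def goal_rule_def)

lemma temporal_query_program_on: "temporal_query (idb Goal 0) (program_on f c)"
  using wf_program_on
  by (auto simp: temporal_query_def program_preds_def program_on_def eval_program_def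
      goal_rule_def)

section \<open>Soundness\<close>

lemma ground_inst_eq_iff:
  assumes "ground_tm t"
  shows "inst_tm so st t = OVal x \<longleftrightarrow> t = OC x" "inst_tm so st t = TVal k \<longleftrightarrow> t = TC k"
  using assms by (cases t; simp)+

text \<open>Assignments do not affect ground terms, so a fact can be recovered from any of its
  instances.\<close>

lemma ground_inst_atom_eqD:
  assumes "is_fact a" "inst_atom so st a = (p, map OVal xs @ [TVal k])"
  shows "a = Atom p (map OC xs @ [TC k])"
proof -
  obtain ts where a: "a = Atom p ts" and ts: "map (inst_tm so st) ts = map OVal xs @ [TVal k]"
    using assms(2) by (cases a) auto
  have g: "\<forall>t\<in>set ts. ground_tm t" using assms(1) by (auto simp: is_fact_def a)
  have len: "length ts = Suc (length xs)" using arg_cong[OF ts, of length] by simp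
  have "ts = map OC xs @ [TC k]"
  proof (rule nth_equalityI)
    show "length ts = length (map OC xs @ [TC k])" using len by simp
    fix i assume i: "i < length ts"
    have "inst_tm so st (ts ! i) = (map OVal xs @ [TVal k]) ! i"
      using i by (metis nth_map ts)
    then show "ts ! i = (map OC xs @ [TC k]) ! i"
      using i g len by (auto simp: nth_append ground_inst_eq_iff split: if_splits)
  qed
  then show ?thesis using a by simp
qed

text \<open>Only collisions at times from 0 to \<open>now_time\<close> are excluded; values at
  negative times or after \<open>now_time\<close> may be arbitrary.\<close>

locale functional_values =
  fixes E :: "atom set" and now_time :: int and f :: recf and c :: nat
  assumes facts: "\<And>a. a \<in> E \<Longrightarrow> is_fact a \<and> \<not> pred_idb (atom_pred a)"
    and functional: "\<And>x s s'. Atom value_pred [OC x, TC s] \<in> E \<Longrightarrow>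
      Atom value_pred [OC x, TC s'] \<in> E \<Longrightarrow> 0 \<le> s \<Longrightarrow> s < s' \<Longrightarrow> s' \<le> now_time \<Longrightarrow> False"
begin

definition has_value :: "nat \<Rightarrow> nat \<Rightarrow> bool" where
  "has_value x n \<longleftrightarrow> Atom value_pred [OC x, TC (int n)] \<in> E \<and> int n \<le> now_time"

definition dom :: "nat \<Rightarrow> bool" where "dom x \<longleftrightarrow> (\<exists>n. has_value x n)"
text \<open>Outside \<open>dom\<close> the choice is arbitrary; each clause of \<open>sem\<close>
  that mentions \<open>val\<close> of an object also demands \<open>dom\<close> of it.\<close>

definition val :: "nat \<Rightarrow> nat" where "val x = (SOME n. has_value x n)"

lemma has_value_unique: "has_value x n \<Longrightarrow> has_value x m \<Longrightarrow> n = m"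
  using functional[of x "int n" "int m"] functional[of x "int m" "int n"]
  by (cases n m rule: linorder_cases) (auto simp: has_value_def)

lemma has_value_iff: "has_value x n \<longleftrightarrow> dom x \<and> val x = n"
  unfolding dom_def val_def using has_value_unique by (metis someI)

text \<open>An upper bound on what is derivable, relative to all values visible at
  \<open>now_time\<close>. Apart from \<open>Ge\<close>, \<open>Before\<close> and
  \<open>Input\<close> the clauses ignore \<open>t\<close>, which makes persistence immediate;
  claiming too much at earlier times is harmless.\<close>

fun sem :: "pname \<Rightarrow> nat list \<Rightarrow> int \<Rightarrow> bool" where
  "sem (Ev g) os t \<longleftrightarrow> (\<exists>y xs. os = y # xs \<and> dom y \<and> (\<forall>x\<in>set xs. dom x)
      \<and> eval_recf g (map val xs) (val y))"
| "sem (AllPos g) os t \<longleftrightarrow> (\<exists>n xs. os = n # xs \<and> dom n \<and> (\<forall>x\<in>set xs. dom x)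
      \<and> (\<forall>m<val n. \<exists>y. eval_recf g (m # map val xs) y \<and> y \<noteq> 0))"
| "sem Zr os t \<longleftrightarrow> (\<exists>x. os = [x] \<and> dom x \<and> val x = 0)"
| "sem Sc os t \<longleftrightarrow> (\<exists>x y. os = [x, y] \<and> dom x \<and> dom y \<and> val y = Suc (val x))"
| "sem Nt os t \<longleftrightarrow> (\<exists>x. os = [x] \<and> dom x)"
| "sem Ge os t \<longleftrightarrow> 0 \<le> t"
| "sem Before os t \<longleftrightarrow> (\<exists>x s. os = [x] \<and> 0 \<le> s \<and> s < t \<and> Atom value_pred [OC x, TC s] \<in> E)"
| "sem Inp os t \<longleftrightarrow> (\<exists>x. os = [x] \<and> dom x \<and> val x = c)"
| "sem Input os t \<longleftrightarrow> t = int c"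
| "sem Goal os t \<longleftrightarrow> os = [] \<and> eval_recf f [c] 1 \<and> (\<exists>k. Atom trigger_pred [TC k] \<in> E)"

text \<open>Intensional atoms after \<open>now_time\<close> are all true, so rules with heads there
  hold trivially. No rule moves intensional information back in time, so this does not affect heads
  up to \<open>now_time\<close>.\<close>

definition model :: "gatom set" where
  "model = {inst_atom so st a | so st a. a \<in> E} \<union>
     {(idb p (length os), map OVal os @ [TVal t]) | p os t. t \<le> now_time \<longrightarrow> sem p os t}"

lemma idb_in_model_iff:
  "(idb p k, map OVal os @ [TVal t]) \<in> model \<longleftrightarrow>
    k = length os \<and> (t \<le> now_time \<longrightarrow> sem p os t)"
proof -
  have inj: "map OVal os = map OVal os' \<longleftrightarrow> os = os'" for os os'
    by (rule inj_map_eq_map) (simp add: inj_def)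
  have "inst_atom so st a \<noteq> (idb p k, vs)" if "a \<in> E" for so st a vs
    using facts[OF that] by (cases a) auto
  from this[symmetric] show ?thesis by (auto simp: model_def inj)
qed

lemma edb_in_modelD:
  assumes "(p, map OVal os @ [TVal t]) \<in> model" "\<not> pred_idb p"
  shows "Atom p (map OC os @ [TC t]) \<in> E"
  using assms facts by (auto simp: model_def dest!: ground_inst_atom_eqD[OF _ sym])

lemma inst_in_model [simp]:
  "inst_atom so st (now p xs) \<in> model \<longleftrightarrow> (st 0 \<le> now_time \<longrightarrow> sem p (map so xs) (st 0))"
  "inst_atom so st (nxt p xs) \<in> model \<longleftrightarrow>
    (st 0 + 1 \<le> now_time \<longrightarrow> sem p (map so xs) (st 0 + 1))"
  "inst_atom so st (Atom (idb p 0) [TC k]) \<in> model \<longleftrightarrow> (k \<le> now_time \<longrightarrow> sem p [] k)"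
  "inst_atom so st (Atom (idb p (Suc 0)) [OV x, TC k]) \<in> model \<longleftrightarrow> (k \<le> now_time \<longrightarrow> sem p [so x] k)"
  using idb_in_model_iff[of p _ "map so xs"] idb_in_model_iff[of p _ "[]"]
    idb_in_model_iff[of p _ "[so x]"]
  by (auto simp: now_def nxt_def comp_def)

lemma inst_edbD:
  "inst_atom so st (Atom value_pred [OV x, TV 0 k]) \<in> model \<Longrightarrow>
    Atom value_pred [OC (so x), TC (st 0 + k)] \<in> E"
  "inst_atom so st (Atom value_pred [OV x, TC k]) \<in> model \<Longrightarrow>
    Atom value_pred [OC (so x), TC k] \<in> E"
  "inst_atom so st (Atom trigger_pred [TV 0 k]) \<in> model \<Longrightarrow>
    Atom trigger_pred [TC (st 0 + k)] \<in> E"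
  using edb_in_modelD[of value_pred "[so x]"] edb_in_modelD[of trigger_pred "[]"] by auto

lemma nats_in_model:
  "(\<forall>a\<in>set (nats k). inst_atom so st a \<in> model) \<longleftrightarrow>
    (st 0 \<le> now_time \<longrightarrow> (\<forall>i<k. dom (so i)))"
  by (auto simp: nats_def)

lemma has_valueI:
  "Atom value_pred [OC x, TC t] \<in> E \<Longrightarrow> 0 \<le> t \<Longrightarrow> t \<le> now_time \<Longrightarrow> dom x \<and> val x = nat t"
  by (simp add: has_value_iff[symmetric] has_value_def)

lemma model_persist: "p \<in> {Ge, Nt, Zr, Sc, Before, Inp, Goal} \<Longrightarrow> satisfies model (persist p k)"
  unfolding persist_def satisfies.simps by (auto; use less_imp_le in blast)

lemma model_base_rules:
  assumes "r \<in> set base_rules"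
  shows "satisfies model r"
proof -
  have "satisfies model (Rule [] (Atom (idb Ge 0) [TC 0]))"
    by (simp del: inst_atom.simps)
  moreover have "satisfies model (Rule [Atom value_pred [OV 0, TV 0 0], now Ge []] (now Nt [0]))"
    by (auto simp del: inst_atom.simps dest!: inst_edbD has_valueI)
  moreover have "satisfies model (Rule [Atom value_pred [OV 0, TC 0]] (Atom (idb Zr 1) [OV 0, TC 0]))"
    by (auto simp del: inst_atom.simps dest!: inst_edbD has_valueI)
  moreover have "satisfies model
    (Rule [Atom value_pred [OV 0, TV 0 0], Atom value_pred [OV 1, TV 0 1], now Ge []] (nxt Sc [0, 1]))"
    by (auto simp del: inst_atom.simps dest!: inst_edbD has_valueI)
  moreover have "satisfies model (Rule [Atom value_pred [OV 0, TV 0 0], now Ge []] (nxt Before [0]))"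
    by (auto simp del: inst_atom.simps dest!: inst_edbD)
  moreover have "satisfies model (Rule [now Input [], Atom value_pred [OV 0, TV 0 0]] (now Inp [0]))"
    by (auto simp del: inst_atom.simps dest!: inst_edbD has_valueI)
  \<comment> \<open>The body would give one object two values at times between 0 and
    \<open>now_time\<close>, contrary to \<open>functional\<close>.\<close>
  moreover have "satisfies model (Rule [now Before [0], Atom value_pred [OV 0, TV 0 0]] (now Goal []))"
    by (auto simp del: inst_atom.simps dest!: inst_edbD dest: functional)
  ultimately show ?thesis
    using assms model_persist unfolding base_rules_def
    by (auto simp del: satisfies.simps)
qed

text \<open>Under \<open>sem\<close> each rule becomes an introduction rule of
  \<open>eval_recf\<close>, or one step of extending the range on which a function is known to be
  nonzero.\<close>

lemma model_rules_for: "r \<in> set (rules_for k g) \<Longrightarrow> satisfies model r"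
proof (induction k g arbitrary: r rule: rules_for.induct)
  case (1 k)
  then show ?case
    by (auto simp del: inst_atom.simps simp: nats_in_model intro: eval_recf.zero)
next
  case (2 k)
  then show ?case
    by (auto simp del: inst_atom.simps simp: nats_in_model intro: eval_recf.succ split: if_splits)
next
  case (3 k i)
  then show ?case
    by (auto simp del: inst_atom.simps simp: nats_in_model intro!: eval_proj split: if_splits)
next
  case (4 k g gs)
  have "satisfies model (Rule (now (Ev g) (k # [Suc k..<Suc k + length gs]) # nats k @
        map (\<lambda>i. now (Ev (gs ! i)) ((Suc k + i) # [0..<k])) [0..<length gs])
      (now (Ev (Comp g gs)) (k # [0..<k])))"
    by (auto simp del: inst_atom.simps upt_Suc simp: nats_in_model list_all2_conv_all_nth ball_Un
        intro!: eval_recf.comp)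
  with 4 show ?case by (auto simp del: satisfies.simps)
next
  case (5 k g h)
  show ?case
  proof (cases "k = 0")
    case False
    have "satisfies model
      (Rule [now Zr [0], now (Ev g) (k # [1..<k])] (now (Ev (Prec g h)) (k # 0 # [1..<k])))"
      by (auto simp del: inst_atom.simps intro: eval_recf.prec0)
    moreover have "satisfies model
      (Rule [now Sc [0, k + 2], now (Ev (Prec g h)) (k # 0 # [1..<k]),
            now (Ev h) ((k + 1) # k # 0 # [1..<k])]
        (now (Ev (Prec g h)) ((k + 1) # (k + 2) # [1..<k])))"
      by (auto simp del: inst_atom.simps intro: eval_recf.precS)
    ultimately show ?thesis using 5 False by (auto simp del: satisfies.simps)
  qed (use 5 in simp)
next
  case (6 k g)
  have "satisfies model (Rule (now Zr [k] # nats k) (now (AllPos g) (k # [0..<k])))"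
    by (auto simp del: inst_atom.simps simp: nats_in_model)
  moreover have "satisfies model
    (Rule [now (AllPos g) (k # [0..<k]), now (Ev g) ((k + 1) # k # [0..<k]),
          now Sc [k + 2, k + 1], now Sc [k, k + 3]]
      (now (AllPos g) ((k + 3) # [0..<k])))"
    by (auto simp del: inst_atom.simps simp: less_Suc_eq)
  moreover have "satisfies model
    (Rule [now (AllPos g) (k # [0..<k]), now (Ev g) ((k + 1) # k # [0..<k]), now Zr [k + 1]]
      (now (Ev (Mu g)) (k # [0..<k])))"
    by (auto simp del: inst_atom.simps intro: eval_recf.mu)
  ultimately show ?case using 6 by (auto simp del: satisfies.simps)
qed

lemma model_goal_rule: "satisfies model (goal_rule f)"
  by (auto simp del: inst_atom.simps simp: goal_rule_def dest!: inst_edbD)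

lemma model_program: "r \<in> set (program_on f c) \<Longrightarrow> satisfies model r"
  using model_goal_rule model_base_rules model_rules_for
  by (auto simp: program_on_def eval_program_def input_rule_def
      simp del: inst_atom.simps)

lemma model_fact: "a \<in> E \<Longrightarrow> satisfies model (Rule [] a)"
  by (auto simp: model_def)

text \<open>An entailed atom holds in every model, in particular in \<open>model\<close>, where
  \<open>Goal\<close> at \<open>now_time\<close> has exactly this meaning.\<close>

lemma entails_goalD:
  assumes "entails (set (program_on f c) \<union> Rule [] ` E) (idb Goal 0, map OVal os @ [TVal now_time])"
  shows "os = [] \<and> eval_recf f [c] 1 \<and> (\<exists>k. Atom trigger_pred [TC k] \<in> E)"
proof -
  have "(idb Goal 0, map OVal os @ [TVal now_time]) \<in> model"
    using assms model_program model_fact unfolding entails_def by blast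
  then show ?thesis by (auto simp: idb_in_model_iff)
qed

end

section \<open>Completeness\<close>

definition gatm :: "pname \<Rightarrow> nat list \<Rightarrow> int \<Rightarrow> gatom" where
  "gatm p os t = (idb p (length os), map OVal os @ [TVal t])"

text \<open>Object \<open>i\<close> denotes the number \<open>i\<close>, so in the completeness
  argument numbers can serve directly as objects.\<close>

definition value_facts :: "nat \<Rightarrow> atom set" where
  "value_facts n = (\<lambda>i. Atom value_pred [OC i, TC (int i)]) ` {..n}"

lemma inst_gatm [simp]:
  "inst_atom so st (now p xs) = gatm p (map so xs) (st 0)"
  "inst_atom so st (nxt p xs) = gatm p (map so xs) (st 0 + 1)"
  by (auto simp: now_def nxt_def gatm_def)

lemma entails_rule:
  assumes "Rule b h \<in> R" "\<forall>a\<in>set b. entails R (inst_atom so st a)"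
  shows "entails R (inst_atom so st h)"
  unfolding entails_def
proof (intro allI impI)
  fix I assume I: "\<forall>r\<in>R. satisfies I r"
  then have "satisfies I (Rule b h)" using assms(1) by blast
  moreover have "\<forall>a\<in>set b. inst_atom so st a \<in> I" using assms(2) I by (auto simp: entails_def)
  ultimately show "inst_atom so st h \<in> I" by auto
qed

lemma entails_mono: "entails R g \<Longrightarrow> R \<subseteq> R' \<Longrightarrow> entails R' g"
  by (auto simp: entails_def)

lemma entails_persist:
  assumes "persist p k \<in> R" "entails R (gatm p os t)" "length os = k" "t \<le> t'"
  shows "entails R (gatm p os t')"
  using assms(4)
proof (induction t' rule: int_ge_induct)
  case base
  show ?case by fact
next
  case (step t')
  have "map ((!) os) [0..<k] = os" using assms(3) map_nth by auto
  with step entails_rule[OF assms(1)[unfolded persist_def], of "(!) os" "\<lambda>_. t'"]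
  show ?case by simp
qed

lemma base_rules_persist:
  "persist Ge 0 \<in> set base_rules" "persist Nt 1 \<in> set base_rules"
  "persist Zr 1 \<in> set base_rules" "persist Sc 2 \<in> set base_rules"
  "persist Before 1 \<in> set base_rules" "persist Inp 1 \<in> set base_rules"
  "persist Goal 0 \<in> set base_rules"
  by (auto simp: base_rules_def)

lemma map_nth_middle:
  "map ((!) (us @ vs @ ws)) [length us..<length us + length vs] = vs"
  by (rule nth_equalityI) (auto simp: nth_append)

locale with_base_rules =
  fixes R :: "rule set"
  assumes base: "set base_rules \<subseteq> R"
begin

lemma entails_Ge:
  assumes "0 \<le> t"
  shows "entails R (gatm Ge [] t)"
proof -
  have "Rule [] (Atom (idb Ge 0) [TC 0]) \<in> R" using base by (auto simp: base_rules_def)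
  from entails_rule[OF this] have "entails R (gatm Ge [] 0)" by (simp add: gatm_def)
  then show ?thesis using entails_persist base base_rules_persist(1) assms by auto
qed

text \<open>The earlier value yields \<open>Before\<close>, which persists until the later value
  appears; \<open>Goal\<close> then persists to \<open>t\<close>. No trigger is involved.\<close>

lemma entails_collision:
  assumes "Rule [] (Atom value_pred [OC x, TC s]) \<in> R" "Rule [] (Atom value_pred [OC x, TC s']) \<in> R"
    and "0 \<le> s" "s < s'" "s' \<le> t"
  shows "entails R (gatm Goal [] t)"
proof -
  have v: "entails R (value_pred, [OVal x, TVal s])" "entails R (value_pred, [OVal x, TVal s'])"
    using entails_rule[OF assms(1)] entails_rule[OF assms(2)] by auto
  have "Rule [Atom value_pred [OV 0, TV 0 0], now Ge []] (nxt Before [0]) \<in> R"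
    using base by (auto simp: base_rules_def)
  from entails_rule[OF this, of "\<lambda>_. x" "\<lambda>_. s"]
  have "entails R (gatm Before [x] (s + 1))" using v entails_Ge assms(3) by auto
  then have "entails R (gatm Before [x] s')"
    using entails_persist base base_rules_persist(5) assms(4) by auto
  moreover have "Rule [now Before [0], Atom value_pred [OV 0, TV 0 0]] (now Goal []) \<in> R"
    using base by (auto simp: base_rules_def)
  from entails_rule[OF this, of "\<lambda>_. x" "\<lambda>_. s'"]
  have "entails R (gatm Before [x] s') \<Longrightarrow> entails R (gatm Goal [] s')" using v by auto
  ultimately show ?thesis
    using entails_persist base base_rules_persist(7) assms(5) by auto
qed

end

locale value_rules = with_base_rules +
  fixes N :: nat
  assumes value_facts: "Rule [] ` value_facts N \<subseteq> R"
begin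

lemma entails_value: "i \<le> N \<Longrightarrow> entails R (value_pred, [OVal i, TVal (int i)])"
  using entails_rule[of "[]" "Atom value_pred [OC i, TC (int i)]"] value_facts
  by (auto simp: value_facts_def)

lemma entails_Nt: "i \<le> N \<Longrightarrow> entails R (gatm Nt [i] (int N))"
proof -
  assume i: "i \<le> N"
  have "Rule [Atom value_pred [OV 0, TV 0 0], now Ge []] (now Nt [0]) \<in> R"
    using base by (auto simp: base_rules_def)
  from entails_rule[OF this, of "\<lambda>_. i" "\<lambda>_. int i"]
  have "entails R (gatm Nt [i] (int i))" using i entails_Ge entails_value by auto
  then show ?thesis using entails_persist base base_rules_persist(2) i by auto
qed

lemma entails_Zr: "entails R (gatm Zr [0] (int N))"
proof -
  have "Rule [Atom value_pred [OV 0, TC 0]] (Atom (idb Zr 1) [OV 0, TC 0]) \<in> R"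
    using base by (auto simp: base_rules_def)
  from entails_rule[OF this, of "\<lambda>_. 0"]
  have "entails R (gatm Zr [0] 0)" using entails_value[of 0] by (auto simp: gatm_def)
  then show ?thesis using entails_persist base base_rules_persist(3) by auto
qed

lemma entails_Sc: "i < N \<Longrightarrow> entails R (gatm Sc [i, Suc i] (int N))"
proof -
  assume i: "i < N"
  have "Rule [Atom value_pred [OV 0, TV 0 0], Atom value_pred [OV 1, TV 0 1], now Ge []]
       (nxt Sc [0, 1]) \<in> R"
    using base by (auto simp: base_rules_def)
  from entails_rule[OF this, of "\<lambda>x. if x = 0 then i else Suc i" "\<lambda>_. int i"]
  have "entails R (gatm Sc [i, Suc i] (int i + 1))"
    using i entails_Ge entails_value[of i] entails_value[of "Suc i"] by (auto simp: add.commute)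
  then show ?thesis using entails_persist base base_rules_persist(4) i by auto
qed

lemma entails_nats: "\<forall>x\<in>set xs. x \<le> N \<Longrightarrow> a \<in> set (nats (length xs)) \<Longrightarrow>
    entails R (inst_atom ((!) (xs @ ys)) (\<lambda>_. int N) a)"
  by (auto simp: nats_def nth_append entails_Nt)

end

section \<open>Derivability from sufficiently many objects\<close>

lemma eventually_le_all: "\<forall>\<^sub>F N in sequentially. \<forall>x\<in>set xs. x \<le> N"
  by (auto simp: eventually_ball_finite_distrib eventually_ge_at_top)

lemma map_nth_prefix: "map ((!) (xs @ ys)) [0..<length xs] = xs"
  using map_nth_middle[of "[]" xs ys] by simp

lemma map_nth_Cons_prefix: "map ((!) (x # xs @ ys)) [Suc 0..<Suc (length xs)] = xs"
  using map_nth_middle[of "[x]" xs ys] by simp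

context with_base_rules
begin

text \<open>Everything is inspected at the common time \<open>N\<close>, by which all value facts
  are visible.\<close>

abbreviation derives :: "nat \<Rightarrow> pname \<Rightarrow> nat list \<Rightarrow> bool" where
  "derives N p os \<equiv> entails (R \<union> Rule [] ` value_facts N) (gatm p os (int N))"

lemma value_rules: "value_rules (R \<union> Rule [] ` value_facts N) N"
  using base by unfold_locales auto

lemmas derives_Nt = value_rules.entails_Nt[OF value_rules]
lemmas derives_Zr = value_rules.entails_Zr[OF value_rules]
lemmas derives_Sc = value_rules.entails_Sc[OF value_rules]
lemmas derives_nats = value_rules.entails_nats[OF value_rules]

lemma derives_rule:
  assumes "Rule b (now p zs) \<in> R"
    and "\<forall>a\<in>set b.
      entails (R \<union> Rule [] ` value_facts N) (inst_atom so (\<lambda>_. int N) a)"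
  shows "derives N p (map so zs)"
  using entails_rule[of b "now p zs" _ so "\<lambda>_. int N"] assms by auto

text \<open>An evaluation touches finitely many numbers, hence finitely many objects. Stating
  derivability for all large \<open>N\<close> lets the premises of a rule share one \<open>N\<close>
  without computing bounds.\<close>

lemma eventually_derives_eval:
  assumes "eval_recf f xs y" "set (rules_for (length xs) f) \<subseteq> R"
  shows "\<forall>\<^sub>F N in sequentially. derives N (Ev f) (y # xs)"
  using assms
proof (induction rule: eval_recf.induct)
  case (zero xs)
  have r: "Rule (now Zr [length xs] # nats (length xs)) (now (Ev Zero) (length xs # [0..<length xs])) \<in> R"
    using zero by auto
  show ?case using eventually_le_all[of xs]
  proof eventually_elim
    case (elim N)
    \<comment> \<open>Assignments are lists indexed by variable number: first the arguments, then
      the witnesses for the variables from the arity upwards.\<close>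
    show ?case
      using derives_rule[OF r, of N "(!) (xs @ [0])"] derives_nats[OF elim] derives_Zr
      by (auto simp: map_nth_prefix)
  qed
next
  case (succ x xs)
  let ?k = "length (x # xs)"
  have r: "Rule (now Sc [0, ?k] # nats ?k) (now (Ev Succ) (?k # 0 # [1..<?k])) \<in> R"
    using succ by auto
  show ?case using eventually_le_all[of "Suc x # x # xs"]
  proof eventually_elim
    case (elim N)
    then show ?case
      using derives_rule[OF r, of N "(!) ((x # xs) @ [Suc x])"] derives_nats[of "x # xs" N]
        derives_Sc[of x N]
      by (auto simp: map_nth_Cons_prefix nth_append simp del: upt_Suc)
  qed
next
  case (proj i xs)
  let ?k = "length xs"
  have r: "Rule (nats ?k) (now (Ev (Proj i)) (i # [0..<?k])) \<in> R"
    using proj by auto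
  show ?case using eventually_le_all[of xs]
  proof eventually_elim
    case (elim N)
    then show ?case
      using derives_rule[OF r, of N "(!) (xs @ [])"] derives_nats[OF elim, of _ "[]"]
        map_nth_prefix[of xs "[]"] proj
      by auto
  qed
next
  case (comp xs gs ys f z)
  let ?k = "length xs"
  have len: "length ys = length gs" using comp.IH(1) by (auto simp: list_all2_conv_all_nth)
  have r: "Rule (now (Ev f) (?k # [Suc ?k..<Suc ?k + length gs]) # nats ?k @
        map (\<lambda>i. now (Ev (gs ! i)) ((Suc ?k + i) # [0..<?k])) [0..<length gs])
      (now (Ev (Comp f gs)) (?k # [0..<?k])) \<in> R"
    using comp.prems by auto
  have "\<forall>\<^sub>F N in sequentially. derives N (Ev (gs ! i)) (ys ! i # xs)" if i: "i < length gs" for i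
  proof -
    have "set (rules_for ?k (gs ! i)) \<subseteq> set (rules_for ?k (Comp f gs))"
      unfolding rules_for.simps using nth_mem[OF i] by auto
    with comp.prems have "set (rules_for ?k (gs ! i)) \<subseteq> R" by (rule order_trans[rotated])
    with list_all2_nthD[OF comp.IH(1) i] show ?thesis by blast
  qed
  then have "\<forall>\<^sub>F N in sequentially. \<forall>i\<in>{..<length gs}. derives N (Ev (gs ! i)) (ys ! i # xs)"
    by (intro eventually_ball_finite) auto
  moreover have "\<forall>\<^sub>F N in sequentially. derives N (Ev f) (z # ys)"
    using comp.IH(2) comp.prems len by simp
  ultimately show ?case using eventually_le_all[of xs]
  proof eventually_elim
    case (elim N)
    \<comment> \<open>The arguments come first, then the result at position \<open>?k\<close>, then
      the intermediate values.\<close>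
    let ?so = "(!) (xs @ z # ys)"
    have ys: "map ?so [Suc ?k..<Suc ?k + length gs] = ys"
      using map_nth_middle[of "xs @ [z]" ys "[]"] len by simp
    have xs: "map ?so [0..<?k] = xs" by (rule map_nth_prefix)
    have so: "?so (Suc ?k + i) = ys ! i" "?so ?k = z" for i by (simp_all add: nth_append)
    have "derives N (Ev (Comp f gs)) (map ?so (?k # [0..<?k]))"
    proof (rule derives_rule[OF r], rule ballI)
      fix a assume "a \<in> set (now (Ev f) (?k # [Suc ?k..<Suc ?k + length gs]) # nats ?k @
        map (\<lambda>i. now (Ev (gs ! i)) ((Suc ?k + i) # [0..<?k])) [0..<length gs])"
      then consider "a = now (Ev f) (?k # [Suc ?k..<Suc ?k + length gs])" | "a \<in> set (nats ?k)"
        | i where "i < length gs" "a = now (Ev (gs ! i)) ((Suc ?k + i) # [0..<?k])"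
        by (auto simp del: upt_Suc)
      then show "entails (R \<union> Rule [] ` value_facts N) (inst_atom ?so (\<lambda>_. int N) a)"
      proof cases
        case 1
        then show ?thesis using elim(2) by (simp only: inst_gatm list.map ys so)
      next
        case 2
        then show ?thesis by (rule derives_nats[OF elim(3)])
      next
        case 3
        then show ?thesis using elim(1) by (simp only: inst_gatm list.map xs so lessThan_iff)
      qed
    qed
    then show ?case by (simp only: list.map xs so)
  qed
next
  case (prec0 f xs y g)
  let ?k = "length (0 # xs)"
  have r: "Rule [now Zr [0], now (Ev f) (?k # [1..<?k])] (now (Ev (Prec f g)) (?k # 0 # [1..<?k])) \<in> R"
    using prec0.prems by auto
  have "\<forall>\<^sub>F N in sequentially. derives N (Ev f) (y # xs)"
    using prec0 by auto
  then show ?case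
  proof eventually_elim
    case (elim N)
    show ?case
      using derives_rule[OF r, of N "(!) (0 # xs @ [y])"] derives_Zr elim
      by (auto simp: map_nth_Cons_prefix nth_append simp del: upt_Suc)
  qed
next
  case (precS f g n xs y z)
  let ?k = "length (n # xs)"
  have r: "Rule [now Sc [0, ?k + 2], now (Ev (Prec f g)) (?k # 0 # [1..<?k]),
            now (Ev g) ((?k + 1) # ?k # 0 # [1..<?k])]
        (now (Ev (Prec f g)) ((?k + 1) # (?k + 2) # [1..<?k])) \<in> R"
    using precS.prems by auto
  have "\<forall>\<^sub>F N in sequentially. derives N (Ev (Prec f g)) (y # n # xs)"
    "\<forall>\<^sub>F N in sequentially. derives N (Ev g) (z # y # n # xs)"
    using precS by auto
  then show ?case using eventually_gt_at_top[of n]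
  proof eventually_elim
    case (elim N)
    show ?case
      using derives_rule[OF r, of N "(!) (n # xs @ [y, z, Suc n])"] derives_Sc elim
      by (auto simp: map_nth_Cons_prefix nth_append simp del: upt_Suc)
  qed
next
  case (mu f n xs)
  let ?k = "length xs"
  have r0: "Rule (now Zr [?k] # nats ?k) (now (AllPos f) (?k # [0..<?k])) \<in> R"
    and rS: "Rule [now (AllPos f) (?k # [0..<?k]), now (Ev f) ((?k + 1) # ?k # [0..<?k]),
          now Sc [?k + 2, ?k + 1], now Sc [?k, ?k + 3]]
      (now (AllPos f) ((?k + 3) # [0..<?k])) \<in> R"
    and r: "Rule [now (AllPos f) (?k # [0..<?k]), now (Ev f) ((?k + 1) # ?k # [0..<?k]),
        now Zr [?k + 1]] (now (Ev (Mu f)) (?k # [0..<?k])) \<in> R"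
    using mu.prems by auto
  \<comment> \<open>The search for the least zero is replayed from 0 up to \<open>n\<close>.\<close>
  have "\<forall>\<^sub>F N in sequentially. derives N (AllPos f) (m # xs)" if "m \<le> n" for m
    using that
  proof (induction m)
    case 0
    show ?case using eventually_le_all[of xs]
    proof eventually_elim
      case (elim N)
      show ?case
        using derives_rule[OF r0, of N "(!) (xs @ [0])"] derives_nats[OF elim] derives_Zr
        by (auto simp: map_nth_prefix)
    qed
  next
    case (Suc m)
    then obtain y where y: "\<forall>\<^sub>F N in sequentially. derives N (Ev f) (y # m # xs)" "y \<noteq> 0"
      using mu.IH(2) mu.prems by (auto simp: Suc_le_eq)
    have "\<forall>\<^sub>F N in sequentially. derives N (AllPos f) (m # xs)" using Suc by auto
    with y(1) show ?case using eventually_gt_at_top[of m] eventually_gt_at_top[of "y - 1"]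
    proof eventually_elim
      case (elim N)
      \<comment> \<open>That \<open>y\<close> is nonzero is expressed positively:
        \<open>y - 1\<close> is an object whose successor is \<open>y\<close>.\<close>
      show ?case
        using derives_rule[OF rS, of N "(!) (xs @ [m, y, y - 1, Suc m])"]
          derives_Sc[of m N] derives_Sc[of "y - 1" N] elim y(2)
        by (auto simp: map_nth_prefix nth_append)
    qed
  qed
  from this[of n] have "\<forall>\<^sub>F N in sequentially. derives N (AllPos f) (n # xs)" by simp
  moreover have "\<forall>\<^sub>F N in sequentially. derives N (Ev f) (0 # n # xs)" using mu by auto
  ultimately show ?case
  proof eventually_elim
    case (elim N)
    show ?case
      using derives_rule[OF r, of N "(!) (xs @ [n, 0])"] derives_Zr elim
      by (auto simp: map_nth_prefix nth_append)
  qed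
qed

end

lemma eval_program_goal:
  assumes "eval_recf f [c] 1"
  obtains N where "entails
    (set (program_on f c) \<union> Rule [] ` (value_facts N \<union> {Atom trigger_pred [TC (int N + 1)]}))
    (gatm Goal [] (int N))"
proof -
  define R where "R = set (program_on f c)"
  have sub: "set base_rules \<subseteq> R" "set (rules_for 1 f) \<subseteq> R"
    by (auto simp: R_def program_on_def eval_program_def)
  interpret with_base_rules R using sub by unfold_locales
  have "\<forall>\<^sub>F N in sequentially. derives N (Ev f) [1, c]"
    using eventually_derives_eval[OF assms] sub(2) by simp
  \<comment> \<open>The bounds make the objects 0, 1 and \<open>c\<close> available, and let
    \<open>Inp\<close>, which arises at time \<open>c\<close>, persist to \<open>N\<close>.\<close>
  then have "\<forall>\<^sub>F N in sequentially. derives N (Ev f) [1, c] \<and> 1 < N \<and> c < N"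
    by (intro eventually_conj eventually_gt_at_top)
  then obtain N where N: "derives N (Ev f) [1, c]" "1 < N" "c < N"
    by (auto simp: eventually_sequentially)
  define S where "S = R \<union> Rule [] ` (value_facts N \<union> {Atom trigger_pred [TC (int N + 1)]})"
  interpret S: value_rules S N
    using sub(1) by unfold_locales (auto simp: S_def)
  have "entails S (gatm Input [] (int c))"
    using entails_rule[of "[]" "Atom (idb Input 0) [TC (int c)]" S]
    by (auto simp: S_def R_def program_on_def input_rule_def gatm_def)
  moreover have "Rule [now Input [], Atom value_pred [OV 0, TV 0 0]] (now Inp [0]) \<in> S"
    using S.base by (auto simp: base_rules_def)
  from entails_rule[OF this, of "\<lambda>_. c" "\<lambda>_. int c"]
  have "entails S (gatm Input [] (int c)) \<Longrightarrow> entails S (gatm Inp [c] (int c))"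
    using S.entails_value[of c] N(3) by auto
  ultimately have "entails S (gatm Inp [c] (int N))"
    using entails_persist S.base base_rules_persist(6) N(3) by auto
  moreover have "entails S (gatm (Ev f) [1, c] (int N))"
    using N(1) by (rule entails_mono) (auto simp: S_def)
  moreover have "entails S (trigger_pred, [TVal (int N + 1)])"
    using entails_rule[of "[]" "Atom trigger_pred [TC (int N + 1)]" S] by (auto simp: S_def)
  moreover have "goal_rule f \<in> S"
    by (auto simp: S_def R_def program_on_def eval_program_def)
  \<comment> \<open>In \<open>[c, 1, 0]\<close> the entries are the input, the result and the zero
    that certifies the result as 1.\<close>
  ultimately have "entails S (gatm Goal [] (int N))"
    using entails_rule[of _ _ S "(!) [c, 1, 0]" "\<lambda>_. int N"] S.entails_Zr S.entails_Sc[of 0] N(2)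
    unfolding goal_rule_def by fastforce
  then show ?thesis using that unfolding S_def R_def by blast
qed

section \<open>Delay and the diagonal argument\<close>

lemma answers_mono: "D \<subseteq> D' \<Longrightarrow> answers P Pi D t \<subseteq> answers P Pi D' t"
  unfolding answers_def by (auto elim!: entails_mono)

text \<open>Ground atoms carry no arity check, but the set of all atoms of correct length is a model
  of rules with well-formed heads. Applied to \<open>Goal\<close>, this leaves only the empty answer
  tuple.\<close>

lemma entails_length:
  assumes "\<And>b h. Rule b h \<in> R \<Longrightarrow> wf_atom h" "entails R (p, vs)"
  shows "length vs = length (pred_sig p)"
proof -
  let ?I = "{(p, vs). length vs = length (pred_sig p)}"
  have "satisfies ?I r" if "r \<in> R" for r
  proof (cases r)
    case (Rule b h)
    then have "wf_atom h" using assms(1) that by simp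
    then show ?thesis
      by (cases h) (auto simp: Rule wf_atom_def dest: arg_cong[where f = length])
  qed
  then show ?thesis using assms(2) unfolding entails_def by blast
qed

lemma value_fact_atD: "temporal_fact_at (Atom value_pred [OC x, TC s]) t \<Longrightarrow> t = s"
  by (simp add: temporal_fact_at_def)

lemma delay_holds_iff:
  "delay_holds ((idb Goal 0, program_on f c), 0) \<longleftrightarrow> \<not> eval_recf f [c] 1"
proof
  assume delay: "delay_holds ((idb Goal 0, program_on f c), 0)"
  show "\<not> eval_recf f [c] 1"
  proof
    assume "eval_recf f [c] 1"
    then obtain N where N: "entails
      (set (program_on f c) \<union> Rule [] ` (value_facts N \<union> {Atom trigger_pred [TC (int N + 1)]}))
      (gatm Goal [] (int N))" by (rule eval_program_goal)
    \<comment> \<open>The evaluation lies in the history; the update consists of the trigger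
      alone.\<close>
    let ?U = "{Atom trigger_pred [TC (int N + 1)]}"
    have h: "history (int N) (value_facts N)"
      by (auto simp: history_def dataset_def value_facts_def is_fact_def temporal_fact_at_def)
    have "update (int N) ?U"
      by (auto simp: update_def dataset_def is_fact_def temporal_fact_at_def)
    with h delay have "answers (idb Goal 0) (program_on f c) (value_facts N) (int N)
      = answers (idb Goal 0) (program_on f c) (value_facts N \<union> ?U) (int N)"
      unfolding delay_holds_def by auto
    moreover have "[] \<in> answers (idb Goal 0) (program_on f c) (value_facts N \<union> ?U) (int N)"
      using N by (simp add: answers_def gatm_def)
    ultimately have "[] \<in> answers (idb Goal 0) (program_on f c) (value_facts N) (int N)" by simp
    then have ent: "entails (set (program_on f c) \<union> Rule [] ` value_facts N)
        (idb Goal 0, map OVal [] @ [TVal (int N)])"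
      by (simp add: answers_def)
    \<comment> \<open>These values are functional and come without a trigger, so soundness refutes
      \<open>Goal\<close> over the history alone.\<close>
    interpret functional_values "value_facts N" "int N" f c
      using h by unfold_locales (auto simp: history_def dataset_def value_facts_def)
    from entails_goalD[OF ent] show False by (auto simp: value_facts_def value_pred_def trigger_pred_def)
  qed
next
  assume no: "\<not> eval_recf f [c] 1"
  have "answers (idb Goal 0) (program_on f c) (D \<union> U) t
      \<subseteq> answers (idb Goal 0) (program_on f c) D t" if D: "history t D" and U: "update t U" for t D U
  proof (rule subsetI)
    fix os assume "os \<in> answers (idb Goal 0) (program_on f c) (D \<union> U) t"
    then have ent: "entails (set (program_on f c) \<union> Rule [] ` (D \<union> U))
        (idb Goal 0, map OVal os @ [TVal t])"
      by (simp add: answers_def)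
    have facts: "\<And>a. a \<in> D \<union> U \<Longrightarrow> is_fact a \<and> \<not> pred_idb (atom_pred a)"
      using D U by (auto simp: history_def update_def dataset_def)
    \<comment> \<open>Without a collision, soundness would turn the answer into an evaluation of
      \<open>f\<close> at \<open>c\<close> to 1.\<close>
    have "\<not> functional_values (D \<union> U) t"
      using functional_values.entails_goalD[OF _ ent] no by blast
    then obtain x s s' where xs: "Atom value_pred [OC x, TC s] \<in> D \<union> U"
        "Atom value_pred [OC x, TC s'] \<in> D \<union> U" "0 \<le> s" "s < s'" "s' \<le> t"
      using facts unfolding functional_values_def by blast
    have wf: "wf_atom h" if "Rule b h \<in> set (program_on f c) \<union> Rule [] ` (D \<union> U)" for b h
      using that wf_program_on facts by (fastforce simp: wf_program_def is_fact_def)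
    \<comment> \<open>Both colliding values lie at times at most \<open>t\<close>, while facts of
      the update are later; so the history alone yields the collision.\<close>
    from xs U have "Atom value_pred [OC x, TC s] \<in> D" "Atom value_pred [OC x, TC s'] \<in> D"
      by (auto simp: update_def dest!: value_fact_atD)
    moreover have "os = []" using entails_length[OF wf ent] by simp
    moreover have "with_base_rules (set (program_on f c) \<union> Rule [] ` D)"
      by unfold_locales (auto simp: program_on_def eval_program_def)
    ultimately show "os \<in> answers (idb Goal 0) (program_on f c) D t"
      using with_base_rules.entails_collision[of _ x s s' t] xs by (auto simp: answers_def gatm_def)
  qed
  then show "delay_holds ((idb Goal 0, program_on f c), 0)"
    unfolding delay_holds_def by (simp add: subset_antisym answers_mono)
qed

text \<open>Follows \<open>enc_instance\<close> symbol by symbol: \<open>Succ\<close> of a pair is a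
  list cell, and the sum of the input with itself is \<open>int_encode\<close> of a nonnegative
  number. The input is used twice, as the time point in the input rule and as the code of the
  remaining rule list.\<close>

definition code_recf :: recf where
  "code_recf = pair_recf
     (pair_recf (const_recf (enc_pred (idb Goal 0)))
       (Comp Succ [pair_recf
         (pair_recf Zero
           (pair_recf (const_recf (enc_pred (idb Input 0)))
             (Comp Succ [pair_recf (pair_recf (const_recf 2) (Comp add_recf [Proj 0, Proj 0])) Zero])))
         (Proj 0)]))
     Zero"

lemma eval_code_recf:
  assumes "c = list_encode (map enc_rule (eval_program f))"
  shows "eval_recf code_recf [c] (enc_instance ((idb Goal 0, program_on f c), 0))"
proof -
  have "int_encode (int c) = c + c" by (simp add: int_encode_def sum_encode_def)
  then show ?thesis
    unfolding code_recf_def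
    by (auto simp: program_on_def input_rule_def assms[symmetric]
        intro!: eval_pair_recf eval_const_recf eval_comp1[OF _ eval_recf.succ]
          eval_comp2[OF _ _ eval_add_recf] eval_recf.zero eval_proj)
qed

theorem theorem10:
  shows "\<not> decidable_problem valid_delay_instance enc_instance delay_holds"
proof
  assume "decidable_problem valid_delay_instance enc_instance delay_holds"
  then obtain g where g: "\<And>x. valid_delay_instance x \<Longrightarrow>
      eval_recf g [enc_instance x] (if delay_holds x then 1 else 0)"
    unfolding decidable_problem_def by blast
  \<comment> \<open>\<open>f\<close> asks the supposed decision procedure about the instance built
    from its input; \<open>c\<close> is chosen so that this instance concerns \<open>f\<close> on
    \<open>c\<close> itself.\<close>
  define f where "f = Comp g [code_recf]"
  define c where "c = list_encode (map enc_rule (eval_program f))"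
  let ?inst = "((idb Goal 0, program_on f c), 0)"
  have "valid_delay_instance ?inst"
    by (simp add: valid_delay_instance_def temporal_query_program_on)
  from eval_comp1[OF eval_code_recf[OF c_def] g[OF this]]
  have "eval_recf f [c] (if delay_holds ?inst then 1 else 0)"
    by (simp add: f_def)
  \<comment> \<open>If delay holds, then \<open>f\<close> yields 1 on \<open>c\<close>, so delay
    fails; if it fails, then \<open>f\<close> yields both 0 and 1.\<close>
  then show False
    using delay_holds_iff[of f c] eval_recf_deterministic by (cases "delay_holds ?inst") fastforce+
qed

end
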